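(* For $\vec\lambda=(\lambda_1,\lambda_2,\lambda_3,\lambda_4)$ with $\lambda_1\ge\lambda_2\ge\lambda_3\ge\lambda_4\ge0$ and $\sum_i\lambda_i=1$, let $$\rho_{\vec\lambda}=\lambda_1\Phi_1+\lambda_2|01\rangle\langle01|+\lambda_3\Phi_2+\lambda_4|10\rangle\langle10|,$$ where $\Phi_1=|\Phi_1\rangle\langle\Phi_1|$ and $\Phi_2=|\Phi_2\rangle\langle\Phi_2|$ with $|\Phi_1\rangle=\frac{1}{\sqrt2}(|00\rangle+|11\rangle)$ and $|\Phi_2\rangle=\frac{1}{\sqrt2}(|00\rangle-|11\rangle)$. There exist choices of $\vec\lambda$ for which $\rho_{\vec\lambda}$ does not maximize all entanglement monotones among all two-qubit states with the same spectrum; that is, there exist $\vec\lambda=(\lambda_1,\lambda_2,\lambda_3,\lambda_4)$ with $\lambda_1\ge\lambda_2\ge\lambda_3\ge\lambda_4\ge0$ and $\sum_i\lambda_i=1$, an entanglement monotone $E$ and a two-qubit state $\sigma$ with spectrum $\vec\lambda$ such that $E(\sigma)>E(\rho_{\vec\lambda})$.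
   Context: A two-qubit state is a $4\times4$ unit-trace Hermitian positive semidefinite complex matrix acting on $\mathbb{C}^2\otimes\mathbb{C}^2$; its spectrum is the list of its eigenvalues counted with multiplicity, in non-increasing order. With $\{|0\rangle,|1\rangle\}$ the standard basis of $\mathbb{C}^2$, write $|ij\rangle=|i\rangle\otimes|j\rangle$. A two-qubit state is separable if it can be written as $\sum_i p_i|\psi_i\rangle\langle\psi_i|\otimes|\chi_i\rangle\langle\chi_i|$ for some convex weights $\{p_i\}$ and unit vectors $|\psi_i\rangle,|\chi_i\rangle\in\mathbb{C}^2$. LOCC (local operations and classical communication): an LOCC instrument is a finite family $\{\Lambda_k\}$ of completely positive maps from $4\times4$ matrices to $4\times4$ matrices, with trace-preserving sum, that can be implemented by a protocol with finitely many rounds, where in each round one of the two parties applies to their own subsystem a quantum instrument (a finite family of completely positive maps whose sum is trace preserving, possibly changing the local dimension) chosen depending on all previous measurement outcomes, and communicates the outcome to the other party; at the end both local systems are qubits and the branches may be grouped, each $\Lambda_k$ being the sum of the branches in the $k$-th group. An LOCC map is an LOCC instrument with a single element. An entanglement monotone is a function $E$ from two-qubit states to $[0,\infty)$ that vanishes on separable states and does not increase on average under LOCC: for every two-qubit state $\rho$ and every LOCC instrument $\{\Lambda_k\}$, with $p_k=\mathrm{tr}\,\Lambda_k(\rho)$, one has $E(\rho)\ge\sum_{k:\,p_k>0}p_k\,E(\Lambda_k(\rho)/p_k)$. (In particular $E(\Lambda(\rho))\le E(\rho)$ for every LOCC map $\Lambda$.) *)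

theory Defs
  imports "Jordan_Normal_Form.Schur_Decomposition"
begin

section \<open>Matrices and tensor products\<close>

definition mat_trace :: "complex mat \<Rightarrow> complex" where
  "mat_trace A = (\<Sum>i<dim_row A. A $$ (i, i))"

text \<open>The type of matrices contains all dimensions and is no additive monoid, so \<^const>\<open>sum\<close>
  is not available; the sum of \<open>d \<times> d\<close> matrices is taken entrywise.\<close>

definition mat_sum :: "nat \<Rightarrow> ('i \<Rightarrow> complex mat) \<Rightarrow> 'i set \<Rightarrow> complex mat" where
  "mat_sum d F I = mat d d (\<lambda>ij. \<Sum>k\<in>I. F k $$ ij)"

definition hermitian_mat :: "complex mat \<Rightarrow> bool" where
  "hermitian_mat A \<longleftrightarrow> mat_adjoint A = A"

text \<open>The order on \<^typ>\<open>complex\<close> is that of \<^theory>\<open>HOL-Library.Complex_Order\<close>: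
  \<open>0 \<le> z\<close> says that \<open>z\<close> is real and nonnegative.\<close>

definition psd :: "nat \<Rightarrow> complex mat \<Rightarrow> bool" where
  "psd d A \<longleftrightarrow> A \<in> carrier_mat d d \<and> hermitian_mat A \<and>
     (\<forall>v\<in>carrier_vec d. 0 \<le> (A *\<^sub>v v) \<bullet>c v)"

text \<open>Tensor products use the basis \<open>|i\<rangle> \<otimes> |j\<rangle>\<close> in lexicographic order:
  with second factor of dimension \<open>n\<close>, \<open>|i\<rangle> \<otimes> |j\<rangle>\<close> has index \<open>i * n + j\<close>.\<close>

definition tensor_vec :: "complex vec \<Rightarrow> complex vec \<Rightarrow> complex vec" where
  "tensor_vec u v =
     vec (dim_vec u * dim_vec v) (\<lambda>i. u $ (i div dim_vec v) * v $ (i mod dim_vec v))"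

definition tensor_mat :: "complex mat \<Rightarrow> complex mat \<Rightarrow> complex mat" where
  "tensor_mat A B =
     mat (dim_row A * dim_row B) (dim_col A * dim_col B)
       (\<lambda>(i, j). A $$ (i div dim_row B, j div dim_col B) * B $$ (i mod dim_row B, j mod dim_col B))"

text \<open>\<open>ketbra v\<close> is \<open>|v\<rangle>\<langle>v|\<close>.\<close>

definition ketbra :: "complex vec \<Rightarrow> complex mat" where
  "ketbra v = mat (dim_vec v) (dim_vec v) (\<lambda>(i, j). v $ i * cnj (v $ j))"

definition unit_vector :: "nat \<Rightarrow> complex vec \<Rightarrow> bool" where
  "unit_vector d v \<longleftrightarrow> v \<in> carrier_vec d \<and> v \<bullet>c v = 1"


section \<open>Two-qubit states\<close>

definition two_qubit_state :: "complex mat \<Rightarrow> bool" where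
  "two_qubit_state \<rho> \<longleftrightarrow> psd 4 \<rho> \<and> mat_trace \<rho> = 1"

text \<open>Non-increasing list of the eigenvalues with (algebraic) multiplicity; for the Hermitian
  matrices considered here this coincides with the geometric multiplicity.\<close>

definition has_spectrum :: "complex mat \<Rightarrow> real list \<Rightarrow> bool" where
  "has_spectrum A ls \<longleftrightarrow>
     sorted_wrt (\<ge>) ls \<and> char_poly A = (\<Prod>l\<leftarrow>ls. [:- complex_of_real l, 1:])"

definition separable :: "complex mat \<Rightarrow> bool" where
  "separable \<rho> \<longleftrightarrow> two_qubit_state \<rho> \<and>
     (\<exists>(n :: nat) (p :: nat \<Rightarrow> real) \<psi> \<chi>.
        (\<forall>i<n. 0 \<le> p i) \<and> (\<Sum>i<n. p i) = 1 \<and>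
        (\<forall>i<n. unit_vector 2 (\<psi> i) \<and> unit_vector 2 (\<chi> i)) \<and>
        \<rho> = mat_sum 4
              (\<lambda>i. complex_of_real (p i) \<cdot>\<^sub>m tensor_mat (ketbra (\<psi> i)) (ketbra (\<chi> i))) {..<n})"

definition ket2 :: "nat \<Rightarrow> nat \<Rightarrow> complex vec" where
  "ket2 i j = tensor_vec (unit_vec 2 i) (unit_vec 2 j)"

definition Phi1 :: "complex vec" where
  "Phi1 = complex_of_real (1 / sqrt 2) \<cdot>\<^sub>v (ket2 0 0 + ket2 1 1)"

definition Phi2 :: "complex vec" where
  "Phi2 = complex_of_real (1 / sqrt 2) \<cdot>\<^sub>v (ket2 0 0 - ket2 1 1)"

definition rho_lambda :: "real \<Rightarrow> real \<Rightarrow> real \<Rightarrow> real \<Rightarrow> complex mat" where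
  "rho_lambda l1 l2 l3 l4 =
     complex_of_real l1 \<cdot>\<^sub>m ketbra Phi1 + complex_of_real l2 \<cdot>\<^sub>m ketbra (ket2 0 1) +
     complex_of_real l3 \<cdot>\<^sub>m ketbra Phi2 + complex_of_real l4 \<cdot>\<^sub>m ketbra (ket2 1 0)"


section \<open>Quantum instruments\<close>

type_synonym mat_map = "complex mat \<Rightarrow> complex mat"

definition linear_mat_map :: "nat \<Rightarrow> nat \<Rightarrow> mat_map \<Rightarrow> bool" where
  "linear_mat_map m n L \<longleftrightarrow>
     (\<forall>X\<in>carrier_mat m m. L X \<in> carrier_mat n n) \<and>
     (\<forall>X\<in>carrier_mat m m. \<forall>Y\<in>carrier_mat m m. L (X + Y) = L X + L Y) \<and>
     (\<forall>c. \<forall>X\<in>carrier_mat m m. L (c \<cdot>\<^sub>m X) = c \<cdot>\<^sub>m L X)"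

text \<open>For \<open>L\<close> linear from \<open>m \<times> m\<close> to \<open>n \<times> n\<close> matrices, \<open>id_tensor_map k m n L\<close> is the map
  \<open>id \<otimes> L\<close>, where \<open>id\<close> acts on \<open>k \<times> k\<close> matrices: \<open>L\<close> is applied to each of the \<open>k \<times> k\<close> blocks
  of size \<open>m \<times> m\<close>.  Likewise \<open>tensor_id_map m n k L\<close> is \<open>L \<otimes> id\<close>: \<open>L\<close> is applied to the \<open>m \<times> m\<close>
  matrices obtained by fixing the row and column indices of the second tensor factor.\<close>

definition id_tensor_map :: "nat \<Rightarrow> nat \<Rightarrow> nat \<Rightarrow> mat_map \<Rightarrow> mat_map" where
  "id_tensor_map k m n L X = mat (k * n) (k * n) (\<lambda>(r, c).
     L (mat m m (\<lambda>(a, b). X $$ (r div n * m + a, c div n * m + b))) $$ (r mod n, c mod n))"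

definition tensor_id_map :: "nat \<Rightarrow> nat \<Rightarrow> nat \<Rightarrow> mat_map \<Rightarrow> mat_map" where
  "tensor_id_map m n k L X = mat (n * k) (n * k) (\<lambda>(r, c).
     L (mat m m (\<lambda>(a, b). X $$ (a * k + r mod k, b * k + c mod k))) $$ (r div k, c div k))"

definition completely_positive :: "nat \<Rightarrow> nat \<Rightarrow> mat_map \<Rightarrow> bool" where
  "completely_positive m n L \<longleftrightarrow> linear_mat_map m n L \<and>
     (\<forall>k X. psd (k * m) X \<longrightarrow> psd (k * n) (id_tensor_map k m n L X))"

definition quantum_instrument :: "nat \<Rightarrow> nat \<Rightarrow> mat_map list \<Rightarrow> bool" where
  "quantum_instrument m n Ls \<longleftrightarrow> (\<forall>L\<in>set Ls. completely_positive m n L) \<and>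
     (\<forall>X\<in>carrier_mat m m. mat_trace (mat_sum n (\<lambda>k. (Ls ! k) X) {..<length Ls}) = mat_trace X)"


section \<open>LOCC and entanglement monotones\<close>

text \<open>\<open>locc_branches m n Bs\<close>: some protocol with finitely many rounds, started with local dimensions
  \<open>m\<close> (first party) and \<open>n\<close> (second party) and ending with two qubits, has exactly the list \<open>Bs\<close> of
  branches, one composite map for each complete sequence of outcomes.  The protocol is a finite tree:
  after outcome \<open>k\<close> of the first round the parties continue with a protocol that may depend on \<open>k\<close>,
  whose branches are \<open>Bss ! k\<close>.\<close>

inductive locc_branches :: "nat \<Rightarrow> nat \<Rightarrow> mat_map list \<Rightarrow> bool" where
  stop: "locc_branches 2 2 [\<lambda>X. X]"
| first_party:
    "quantum_instrument m m' Ls \<Longrightarrow> length Bss = length Ls \<Longrightarrow>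
     (\<forall>k<length Ls. locc_branches m' n (Bss ! k)) \<Longrightarrow>
     locc_branches m n
       (concat (map2 (\<lambda>L Bs. map (\<lambda>B. B \<circ> tensor_id_map m m' n L) Bs) Ls Bss))"
| second_party:
    "quantum_instrument n n' Ls \<Longrightarrow> length Bss = length Ls \<Longrightarrow>
     (\<forall>k<length Ls. locc_branches m n' (Bss ! k)) \<Longrightarrow>
     locc_branches m n
       (concat (map2 (\<lambda>L Bs. map (\<lambda>B. B \<circ> id_tensor_map m n n' L) Bs) Ls Bss))"

text \<open>The function \<open>g\<close> assigns to each branch the group to which it belongs.\<close>

definition locc_instrument :: "mat_map list \<Rightarrow> bool" where
  "locc_instrument Ls \<longleftrightarrow> quantum_instrument 4 4 Ls \<and>
     (\<exists>Bs g. locc_branches 2 2 Bs \<and> (\<forall>j<length Bs. g j < length Ls) \<and>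
        (\<forall>k<length Ls. \<forall>X\<in>carrier_mat 4 4.
           (Ls ! k) X = mat_sum 4 (\<lambda>j. (Bs ! j) X) {j. j < length Bs \<and> g j = k}))"

text \<open>Only the values of \<open>E\<close> on two-qubit states are constrained.\<close>

definition entanglement_monotone :: "(complex mat \<Rightarrow> real) \<Rightarrow> bool" where
  "entanglement_monotone E \<longleftrightarrow>
     (\<forall>\<rho>. two_qubit_state \<rho> \<longrightarrow> 0 \<le> E \<rho>) \<and>
     (\<forall>\<rho>. separable \<rho> \<longrightarrow> E \<rho> = 0) \<and>
     (\<forall>\<rho> Ls. two_qubit_state \<rho> \<longrightarrow> locc_instrument Ls \<longrightarrow>
        (let p = (\<lambda>k. Re (mat_trace ((Ls ! k) \<rho>))) in
         (\<Sum>k | k < length Ls \<and> 0 < p k.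
            p k * E (complex_of_real (1 / p k) \<cdot>\<^sub>m (Ls ! k) \<rho>)) \<le> E \<rho>))"

end

theory Submission
  imports Defs
begin

text \<open>Write \<open>X\<^sup>\<Gamma>\<close> for the partial transpose of \<open>X\<close>.  An LOCC protocol preserves both positivity and
  positivity of the partial transpose, so the least trace of a positive \<open>B\<close> with
  \<open>(\<rho> + S + B)\<^sup>\<Gamma> \<ge> 0\<close> for some \<open>S \<le> \<rho>\<close> with \<open>S\<^sup>\<Gamma> \<ge> 0\<close> is an entanglement monotone.  The freedom
  in \<open>S\<close> helps \<open>\<rho>\<^sub>\<lambda> = 2/3 \<Phi>\<^sub>1 + 1/3 |01\<rangle>\<langle>01|\<close>, whose second eigenvector is a product: with
  \<open>S = 1/3 |01\<rangle>\<langle>01|\<close> the cost drops to \<open>1/6\<close>.  It does not help \<open>2/3 \<Phi>\<^sub>1 + 1/3 \<Phi>\<^sub>2\<close>, where the only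
  admissible \<open>S\<close> are diagonal, and whose cost remains its robustness \<open>1/3\<close>.\<close>

section \<open>Positive semidefinite matrices\<close>

text \<open>The quadratic form of \<open>A\<close> at \<open>f\<close>. Test vectors are functions
  on all of \<open>nat\<close>, of which only the first \<open>d\<close> values matter, so that
  choosing or reindexing one leaves no dimension to check.\<close>

definition sesq_form :: "nat \<Rightarrow> complex mat \<Rightarrow> (nat \<Rightarrow> complex) \<Rightarrow> complex" where
  "sesq_form d A f = (\<Sum>i<d. \<Sum>j<d. cnj (f i) * A $$ (i, j) * f j)"

lemma mult_mat_vec_inner:
  assumes "A \<in> carrier_mat d d" "v \<in> carrier_vec d"
  shows "(A *\<^sub>v v) \<bullet>c v = sesq_form d A (\<lambda>i. v $ i)"
  using assms
  by (simp add: sesq_form_def scalar_prod_def lessThan_atLeast0 sum_distrib_left sum_distrib_right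
      mult_ac)

lemma hermitian_mat_iff:
  assumes "A \<in> carrier_mat d d"
  shows "hermitian_mat A \<longleftrightarrow> (\<forall>i<d. \<forall>j<d. cnj (A $$ (i, j)) = A $$ (j, i))"
proof -
  have "mat_adjoint A = mat d d (\<lambda>(i, j). cnj (A $$ (j, i)))"
    using assms by (intro eq_matI) (auto simp: mat_adjoint_def mat_of_rows_def)
  then show ?thesis
    using assms unfolding hermitian_mat_def by (auto simp: mat_eq_iff)
qed

lemma psd_iff:
  "psd d A \<longleftrightarrow> A \<in> carrier_mat d d \<and> (\<forall>i<d. \<forall>j<d. cnj (A $$ (i, j)) = A $$ (j, i)) \<and>
     (\<forall>f. 0 \<le> sesq_form d A f)"
proof -
  have "(\<forall>v\<in>carrier_vec d. 0 \<le> (A *\<^sub>v v) \<bullet>c v) \<longleftrightarrow> (\<forall>f. 0 \<le> sesq_form d A f)"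
    if A: "A \<in> carrier_mat d d"
  proof
    assume L: "\<forall>v\<in>carrier_vec d. 0 \<le> (A *\<^sub>v v) \<bullet>c v"
    show "\<forall>f. 0 \<le> sesq_form d A f"
    proof
      fix f
      have "sesq_form d A f = sesq_form d A (\<lambda>i. vec d f $ i)"
        by (simp add: sesq_form_def)
      moreover have "0 \<le> (A *\<^sub>v vec d f) \<bullet>c vec d f"
        using L vec_carrier by blast
      ultimately show "0 \<le> sesq_form d A f"
        using mult_mat_vec_inner[OF A vec_carrier, of f] by metis
    qed
  qed (simp add: mult_mat_vec_inner[OF A])
  then show ?thesis
    unfolding psd_def by (auto simp: hermitian_mat_iff)
qed

lemma psd_carrier: "psd d A \<Longrightarrow> A \<in> carrier_mat d d"
  by (simp add: psd_def)

lemma psd_cnj: "psd d A \<Longrightarrow> i < d \<Longrightarrow> j < d \<Longrightarrow> cnj (A $$ (i, j)) = A $$ (j, i)"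
  by (simp add: psd_iff)

lemma psdI:
  assumes "A \<in> carrier_mat d d"
    and "\<And>i j. i < d \<Longrightarrow> j < d \<Longrightarrow> cnj (A $$ (i, j)) = A $$ (j, i)"
    and "\<And>f. 0 \<le> sesq_form d A f"
  shows "psd d A"
  unfolding psd_iff using assms by blast

lemma psd_sesq_form: "psd d A \<Longrightarrow> 0 \<le> sesq_form d A f"
  by (simp add: psd_iff)

lemma psd_add:
  assumes "psd d A" "psd d B"
  shows "psd d (A + B)"
proof -
  have c: "A \<in> carrier_mat d d" "B \<in> carrier_mat d d"
    using assms by (auto simp: psd_def)
  have "sesq_form d (A + B) f = sesq_form d A f + sesq_form d B f" for f
    using c by (simp add: sesq_form_def algebra_simps sum.distrib)
  then show ?thesis
    using assms c by (intro psdI) (auto simp: psd_cnj psd_sesq_form)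
qed

lemma psd_smult:
  assumes "psd d A" "0 \<le> r"
  shows "psd d (complex_of_real r \<cdot>\<^sub>m A)"
proof -
  have c: "A \<in> carrier_mat d d"
    using assms by (auto simp: psd_def)
  have "sesq_form d (complex_of_real r \<cdot>\<^sub>m A) f = complex_of_real r * sesq_form d A f" for f
    using c by (simp add: sesq_form_def sum_distrib_left mult_ac)
  then show ?thesis
    using assms c psd_sesq_form[OF assms(1)]
    by (intro psdI) (auto simp: psd_cnj less_eq_complex_def)
qed

lemma psd_mat_sum:
  assumes "\<And>k. k \<in> I \<Longrightarrow> psd d (F k)"
  shows "psd d (mat_sum d F I)"
proof -
  have "sesq_form d (mat_sum d F I) f = (\<Sum>k\<in>I. sesq_form d (F k) f)" for f
  proof -
    have "sesq_form d (mat_sum d F I) f =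
        (\<Sum>i<d. \<Sum>j<d. \<Sum>k\<in>I. cnj (f i) * F k $$ (i, j) * f j)"
      by (simp add: sesq_form_def mat_sum_def sum_distrib_left sum_distrib_right)
    also have "\<dots> = (\<Sum>i<d. \<Sum>k\<in>I. \<Sum>j<d. cnj (f i) * F k $$ (i, j) * f j)"
      by (intro sum.cong[OF refl] sum.swap)
    finally show ?thesis
      by (simp add: sesq_form_def sum.swap[of _ I])
  qed
  then have "0 \<le> sesq_form d (mat_sum d F I) f" for f
    using assms by (simp add: psd_sesq_form sum_nonneg)
  moreover have "cnj (mat_sum d F I $$ (i, j)) = mat_sum d F I $$ (j, i)"
    if "i < d" "j < d" for i j
    using that psd_cnj[OF assms] by (simp add: mat_sum_def)
  ultimately show ?thesis
    by (intro psdI) (auto simp: mat_sum_def)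
qed

text \<open>The form at \<open>f\<close> is the squared modulus of the inner product of
  \<open>f\<close> and \<open>v\<close>.\<close>

lemma psd_ketbra:
  assumes "v \<in> carrier_vec d"
  shows "psd d (ketbra v)"
proof -
  have "sesq_form d (ketbra v) f = (\<Sum>i<d. cnj (f i) * v $ i) * cnj (\<Sum>i<d. cnj (f i) * v $ i)"
    for f
    using assms unfolding sesq_form_def cnj_sum sum_product
    by (intro sum.cong refl) (simp add: ketbra_def)
  then have "sesq_form d (ketbra v) f = complex_of_real ((cmod (\<Sum>i<d. cnj (f i) * v $ i))\<^sup>2)"
    for f
    by (metis complex_norm_square of_real_power)
  then show ?thesis
    using assms by (intro psdI) (auto simp: ketbra_def less_eq_complex_def)
qed

lemma psd_zero: "psd d (0\<^sub>m d d)"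
  by (rule psdI) (simp_all add: sesq_form_def)

text \<open>The form of the pulled back matrix at \<open>f\<close> is the form of \<open>A\<close>
  at the pushforward of \<open>f\<close>, which sums \<open>f\<close> over the fibres of
  \<open>\<pi>\<close>. This covers both the reordering of tensor factors and the extraction of a
  diagonal entry.\<close>

lemma psd_pullback:
  assumes A: "psd d A" and maps: "\<And>i. i < d' \<Longrightarrow> \<pi> i < d"
  shows "psd d' (mat d' d' (\<lambda>(i, j). A $$ (\<pi> i, \<pi> j)))"
proof -
  let ?B = "mat d' d' (\<lambda>(i, j). A $$ (\<pi> i, \<pi> j))"
  have "sesq_form d' ?B f = sesq_form d A (\<lambda>a. \<Sum>i | i < d' \<and> \<pi> i = a. f i)" for f
  proof -
    let ?F = "\<lambda>a. \<Sum>i | i < d' \<and> \<pi> i = a. f i"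
    have group: "(\<Sum>i<d'. g i) = (\<Sum>a<d. \<Sum>i | i < d' \<and> \<pi> i = a. g i)" for g :: "nat \<Rightarrow> complex"
      using sum.group[of "{..<d'}" "{..<d}" \<pi> g] maps by (simp add: image_subset_iff)
    have "(\<Sum>j<d'. x * A $$ (b, \<pi> j) * f j) = (\<Sum>a<d. x * A $$ (b, a) * ?F a)" for b x
      unfolding group by (simp add: sum_distrib_left)
    then have "sesq_form d' ?B f = (\<Sum>i<d'. \<Sum>a<d. cnj (f i) * A $$ (\<pi> i, a) * ?F a)"
      by (simp add: sesq_form_def)
    also have "\<dots> = (\<Sum>b<d. \<Sum>i | i < d' \<and> \<pi> i = b. \<Sum>a<d. cnj (f i) * A $$ (b, a) * ?F a)"
      unfolding group by simp
    also have "\<dots> = sesq_form d A ?F"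
      unfolding sesq_form_def
      by (subst sum.swap) (simp add: sum_distrib_right)
    finally show ?thesis .
  qed
  then show ?thesis
    using A maps by (intro psdI) (auto simp: psd_cnj psd_sesq_form)
qed

lemma psd_diag_nonneg:
  assumes "psd d A" "i < d"
  shows "0 \<le> A $$ (i, i)"
  using psd_sesq_form[OF psd_pullback[OF assms(1), of 1 "\<lambda>_. i"], of "\<lambda>_. 1"] assms(2)
  by (simp add: sesq_form_def)

lemma psd_trace_nonneg:
  assumes "psd d A"
  shows "0 \<le> mat_trace A"
  using assms psd_diag_nonneg[OF assms] psd_carrier[OF assms]
  by (auto simp: mat_trace_def intro!: sum_nonneg)

section \<open>Partial transposition and LOCC\<close>

text \<open>This transposes the first factor; transposing the second one instead gives the transposed
  matrix, which is positive semidefinite under the same condition.\<close>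

definition ptranspose :: "nat \<Rightarrow> nat \<Rightarrow> complex mat \<Rightarrow> complex mat" where
  "ptranspose m n X = mat (m * n) (m * n)
     (\<lambda>(r, c). X $$ (c div n * n + r mod n, r div n * n + c mod n))"

lemma index_less: "a < m \<Longrightarrow> b < n \<Longrightarrow> a * n + b < m * (n::nat)"
  using mult_le_mono1[of "Suc a" m n] by simp

lemma index_bounds:
  fixes r :: nat
  assumes "r < m * n"
  shows "r div n < m" "r mod n < n"
  using assms by (auto simp: less_mult_imp_div_less intro!: mod_less_divisor gr0I)

text \<open>Transposing \<open>A\<close> amounts to conjugating the test vector.\<close>

lemma psd_transpose:
  assumes "psd d A"
  shows "psd d (transpose_mat A)"
proof -
  have c: "A \<in> carrier_mat d d"
    using assms by (rule psd_carrier)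
  have "sesq_form d (transpose_mat A) f = sesq_form d A (\<lambda>i. cnj (f i))" for f
    unfolding sesq_form_def using c by (subst sum.swap) (simp add: mult_ac)
  then show ?thesis
    using assms c by (intro psdI) (auto simp: psd_cnj psd_sesq_form)
qed

text \<open>Transposing the first factor permutes the blocks, while \<open>L\<close> acts inside
  each block.\<close>

lemma id_tensor_map_ptranspose:
  "id_tensor_map k m n L (ptranspose k m X) = ptranspose k n (id_tensor_map k m n L X)"
proof (intro eq_matI)
  fix r c
  assume "r < dim_row (ptranspose k n (id_tensor_map k m n L X))"
    and "c < dim_col (ptranspose k n (id_tensor_map k m n L X))"
  then have rc: "r < k * n" "c < k * n"
    by (auto simp: ptranspose_def)
  note b = index_bounds[OF rc(1)] index_bounds[OF rc(2)]
  have "mat m m (\<lambda>(a, b). ptranspose k m X $$ (r div n * m + a, c div n * m + b)) =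
      mat m m (\<lambda>(a, b). X $$ (c div n * m + a, r div n * m + b))"
    using b by (intro eq_matI) (auto simp: ptranspose_def index_less)
  then show "id_tensor_map k m n L (ptranspose k m X) $$ (r, c) =
      ptranspose k n (id_tensor_map k m n L X) $$ (r, c)"
    using rc b by (simp add: id_tensor_map_def ptranspose_def index_less)
qed (auto simp: id_tensor_map_def ptranspose_def)

text \<open>Here \<open>L\<close> acts on the factor that \<open>ptranspose\<close> transposes, so
  the two do not commute in general. Composed with the full transpose, \<open>ptranspose\<close>
  becomes transposition of the second factor, which \<open>L\<close> leaves alone.\<close>

lemma tensor_id_map_ptranspose:
  "transpose_mat (ptranspose n k (tensor_id_map m n k L X)) =
   tensor_id_map m n k L (transpose_mat (ptranspose m k X))"
proof (intro eq_matI)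
  fix r c
  assume "r < dim_row (tensor_id_map m n k L (transpose_mat (ptranspose m k X)))"
    and "c < dim_col (tensor_id_map m n k L (transpose_mat (ptranspose m k X)))"
  then have rc: "r < n * k" "c < n * k"
    by (auto simp: tensor_id_map_def)
  note b = index_bounds[OF rc(1)] index_bounds[OF rc(2)]
  have "mat m m (\<lambda>(a, b). transpose_mat (ptranspose m k X) $$ (a * k + r mod k, b * k + c mod k)) =
      mat m m (\<lambda>(a, b). X $$ (a * k + c mod k, b * k + r mod k))"
    using b by (intro eq_matI) (auto simp: ptranspose_def index_less)
  then show "transpose_mat (ptranspose n k (tensor_id_map m n k L X)) $$ (r, c) =
      tensor_id_map m n k L (transpose_mat (ptranspose m k X)) $$ (r, c)"
    using rc b by (simp add: tensor_id_map_def ptranspose_def index_less)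
qed (auto simp: tensor_id_map_def ptranspose_def)

text \<open>Conjugating by the swap of the tensor factors turns \<open>L\<close> on the first factor
  into \<open>L\<close> on the second, the form in which \<open>completely_positive\<close> is
  stated.\<close>

lemma tensor_id_map_swap:
  "tensor_id_map m n k L X = mat (n * k) (n * k) (\<lambda>(r, c).
     id_tensor_map k m n L
       (mat (k * m) (k * m) (\<lambda>(r, c). X $$ (r mod m * k + r div m, c mod m * k + c div m)))
     $$ (r mod k * n + r div k, c mod k * n + c div k))" (is "_ = ?R")
proof (intro eq_matI)
  fix r c
  assume "r < dim_row ?R" and "c < dim_col ?R"
  then have rc: "r < n * k" "c < n * k"
    by auto
  note b = index_bounds[OF rc(1)] index_bounds[OF rc(2)]
  have "mat m m (\<lambda>(a, b). mat (k * m) (k * m)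
        (\<lambda>(r, c). X $$ (r mod m * k + r div m, c mod m * k + c div m))
        $$ (r mod k * m + a, c mod k * m + b)) =
      mat m m (\<lambda>(a, b). X $$ (a * k + r mod k, b * k + c mod k))"
    using b by (intro eq_matI) (auto simp: index_less)
  then show "tensor_id_map m n k L X $$ (r, c) = ?R $$ (r, c)"
    using rc b by (simp add: tensor_id_map_def id_tensor_map_def index_less)
qed (auto simp: tensor_id_map_def)

text \<open>Both swaps are pullbacks along index maps; complete positivity handles the map between
  them.\<close>

lemma psd_tensor_id_map:
  assumes L: "completely_positive m n L" and X: "psd (m * k) X"
  shows "psd (n * k) (tensor_id_map m n k L X)"
  unfolding tensor_id_map_swap
proof (rule psd_pullback)
  have "psd (k * m)
      (mat (k * m) (k * m) (\<lambda>(r, c). X $$ (r mod m * k + r div m, c mod m * k + c div m)))"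
    using X by (rule psd_pullback) (simp add: index_less index_bounds)
  then show "psd (k * n) (id_tensor_map k m n L
      (mat (k * m) (k * m) (\<lambda>(r, c). X $$ (r mod m * k + r div m, c mod m * k + c div m))))"
    using L by (simp add: completely_positive_def)
qed (simp add: index_less index_bounds)

text \<open>Complete positivity with an ancilla of dimension 1.\<close>

lemma completely_positive_psd:
  assumes L: "completely_positive m n L" and X: "psd m X"
  shows "psd n (L X)"
proof -
  have "mat m m (\<lambda>(a, b). X $$ (a, b)) = X"
    using psd_carrier[OF X] by auto
  moreover have "L X \<in> carrier_mat n n"
    using L psd_carrier[OF X] by (simp add: completely_positive_def linear_mat_map_def)
  ultimately have "id_tensor_map 1 m n L X = L X"
    by (intro eq_matI) (auto simp: id_tensor_map_def)
  moreover have "psd (1 * n) (id_tensor_map 1 m n L X)"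
    using L X unfolding completely_positive_def by (metis mult_1)
  ultimately show ?thesis
    by simp
qed

lemma psd_ptranspose_tensor_id_map:
  assumes L: "completely_positive m n L" and X: "psd (m * k) (ptranspose m k X)"
  shows "psd (n * k) (ptranspose n k (tensor_id_map m n k L X))"
  using psd_transpose[OF psd_tensor_id_map[OF L psd_transpose[OF X]]]
  by (simp flip: tensor_id_map_ptranspose)

lemma psd_ptranspose_id_tensor_map:
  assumes L: "completely_positive m n L" and X: "psd (k * m) (ptranspose k m X)"
  shows "psd (k * n) (ptranspose k n (id_tensor_map k m n L X))"
  using L X by (simp add: completely_positive_def flip: id_tensor_map_ptranspose)

lemma in_set_concat_map2:
  assumes "length Bss = length Ls" and "B \<in> set (concat (map2 (\<lambda>L Bs. map (f L) Bs) Ls Bss))"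
  shows "\<exists>k<length Ls. \<exists>C\<in>set (Bss ! k). B = f (Ls ! k) C"
proof -
  obtain L Bs where "(L, Bs) \<in> set (zip Ls Bss)" "B \<in> f L ` set Bs"
    using assms(2) by auto
  then show ?thesis
    unfolding in_set_zip using assms(1) by auto
qed

text \<open>Induction on the protocol tree: a branch is one local map followed by a branch of the
  remaining protocol. \<open>X\<close> is generalized because the remaining protocol acts on the
  output of that map, and the partial transpose follows the current local dimensions.\<close>

lemma locc_branches_ptranspose:
  assumes "locc_branches m n Bs"
  shows "B \<in> set Bs \<Longrightarrow> psd (m * n) (ptranspose m n X) \<Longrightarrow> psd 4 (ptranspose 2 2 (B X))"
  using assms
proof (induction arbitrary: B X rule: locc_branches.induct)
  case stop
  then show ?case by simp
next
  case (first_party m m' Ls Bss n)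
  obtain k C where k: "k < length Ls" "C \<in> set (Bss ! k)" "B = C \<circ> tensor_id_map m m' n (Ls ! k)"
    using in_set_concat_map2[OF first_party(2,4)] by blast
  have "completely_positive m m' (Ls ! k)"
    using first_party(1) k(1) by (simp add: quantum_instrument_def)
  from psd_ptranspose_tensor_id_map[OF this first_party(5)]
  show ?case
    using first_party(3) k by auto
next
  case (second_party n n' Ls Bss m)
  obtain k C where k: "k < length Ls" "C \<in> set (Bss ! k)" "B = C \<circ> id_tensor_map m n n' (Ls ! k)"
    using in_set_concat_map2[OF second_party(2,4)] by blast
  have "completely_positive n n' (Ls ! k)"
    using second_party(1) k(1) by (simp add: quantum_instrument_def)
  from psd_ptranspose_id_tensor_map[OF this second_party(5)]
  show ?case
    using second_party(3) k by auto
qed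

lemma ptranspose_mat_sum:
  assumes "d = m * n"
  shows "ptranspose m n (mat_sum d F I) = mat_sum d (\<lambda>k. ptranspose m n (F k)) I"
  using assms
  by (intro eq_matI) (auto simp: ptranspose_def mat_sum_def index_less index_bounds)

text \<open>Each element of the instrument is a sum of branches, and partial transposition commutes
  with sums.\<close>

lemma locc_instrument_ptranspose:
  assumes "locc_instrument Ls" "k < length Ls" "X \<in> carrier_mat 4 4" "psd 4 (ptranspose 2 2 X)"
  shows "psd 4 (ptranspose 2 2 ((Ls ! k) X))"
proof -
  obtain Bs g where Bs: "locc_branches 2 2 Bs"
    and eq: "\<forall>k<length Ls. \<forall>X\<in>carrier_mat 4 4.
        (Ls ! k) X = mat_sum 4 (\<lambda>j. (Bs ! j) X) {j. j < length Bs \<and> g j = k}"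
    using assms(1) unfolding locc_instrument_def by blast
  have "ptranspose 2 2 ((Ls ! k) X) =
      mat_sum 4 (\<lambda>j. ptranspose 2 2 ((Bs ! j) X)) {j. j < length Bs \<and> g j = k}"
    using eq assms(2,3) by (simp add: ptranspose_mat_sum)
  moreover have "psd 4 (ptranspose 2 2 ((Bs ! j) X))" if "j < length Bs" for j
    using locc_branches_ptranspose[OF Bs, of "Bs ! j" X] that assms(4) by simp
  ultimately show ?thesis
    by (auto intro!: psd_mat_sum)
qed

section \<open>The monotone\<close>

text \<open>The value \<open>1\<close> is inserted only in order that the infimum be taken over a nonempty set; as \<open>min 1\<close>
  is concave, this truncation preserves monotonicity on average.\<close>

definition supplemented_costs :: "complex mat \<Rightarrow> real set" where
  "supplemented_costs \<rho> = {Re (mat_trace B) | B S D.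
     psd 4 B \<and> psd 4 D \<and> S \<in> carrier_mat 4 4 \<and> psd 4 (ptranspose 2 2 S) \<and> \<rho> = S + D \<and>
     psd 4 (ptranspose 2 2 (\<rho> + S + B))}"

definition supplemented_robustness :: "complex mat \<Rightarrow> real" where
  "supplemented_robustness \<rho> = Inf (insert 1 (supplemented_costs \<rho>))"

lemma supplemented_costsI:
  assumes "psd 4 B" "psd 4 D" "S \<in> carrier_mat 4 4" "psd 4 (ptranspose 2 2 S)" "\<rho> = S + D"
    "psd 4 (ptranspose 2 2 (\<rho> + S + B))"
  shows "Re (mat_trace B) \<in> supplemented_costs \<rho>"
  using assms unfolding supplemented_costs_def by blast

lemma supplemented_costs_nonneg: "c \<in> supplemented_costs \<rho> \<Longrightarrow> 0 \<le> c"
  unfolding supplemented_costs_def using psd_trace_nonneg by (auto simp: less_eq_complex_def)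

lemma supplemented_robustness_le:
  assumes "c \<in> insert 1 (supplemented_costs \<rho>)"
  shows "supplemented_robustness \<rho> \<le> c"
  unfolding supplemented_robustness_def using assms supplemented_costs_nonneg
  by (intro cInf_lower bdd_belowI[of _ 0]) auto

lemma supplemented_robustness_ge:
  assumes "\<And>c. c \<in> insert 1 (supplemented_costs \<rho>) \<Longrightarrow> b \<le> c"
  shows "b \<le> supplemented_robustness \<rho>"
  unfolding supplemented_robustness_def using assms by (intro cInf_greatest) auto

section \<open>Costs under LOCC, and vanishing on separable states\<close>

lemma ptranspose_smult:
  assumes "X \<in> carrier_mat (m * n) (m * n)"
  shows "ptranspose m n (c \<cdot>\<^sub>m X) = c \<cdot>\<^sub>m ptranspose m n X"
  using assms by (intro eq_matI) (auto simp: ptranspose_def index_less index_bounds)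

lemma ptranspose_zero: "ptranspose m n (0\<^sub>m (m * n) (m * n)) = 0\<^sub>m (m * n) (m * n)"
  by (intro eq_matI) (auto simp: ptranspose_def index_less index_bounds)

lemma mat_trace_smult: "mat_trace (c \<cdot>\<^sub>m A) = c * mat_trace A" if "A \<in> carrier_mat d d"
  using that by (simp add: mat_trace_def sum_distrib_left)

lemma quantum_instrument_trace:
  assumes "quantum_instrument m n Ls" "X \<in> carrier_mat m m"
  shows "(\<Sum>k<length Ls. mat_trace ((Ls ! k) X)) = mat_trace X"
proof -
  have "(Ls ! k) X \<in> carrier_mat n n" if "k < length Ls" for k
    using assms that
    by (auto simp: quantum_instrument_def completely_positive_def linear_mat_map_def)
  then have "(\<Sum>k<length Ls. mat_trace ((Ls ! k) X)) =
      (\<Sum>k<length Ls. \<Sum>i<n. (Ls ! k) X $$ (i, i))"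
    by (intro sum.cong refl) (auto simp: mat_trace_def)
  also have "\<dots> = mat_trace (mat_sum n (\<lambda>k. (Ls ! k) X) {..<length Ls})"
    by (subst sum.swap) (simp add: mat_trace_def mat_sum_def)
  finally show ?thesis
    using assms by (simp add: quantum_instrument_def)
qed

lemma locc_instrument_completely_positive:
  "locc_instrument Ls \<Longrightarrow> k < length Ls \<Longrightarrow> completely_positive 4 4 (Ls ! k)"
  by (simp add: locc_instrument_def quantum_instrument_def)

text \<open>The whole decomposition is sent through the map: complete positivity keeps
  \<open>B\<close> and \<open>D\<close> positive, and LOCC keeps the partial transposes of
  \<open>S\<close> and \<open>\<rho> + S + B\<close> positive. Since \<open>S\<close> itself may
  fail to be positive, \<open>locc_instrument_ptranspose\<close> speaks of arbitrary matrices. The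
  factor \<open>c\<close> will be the normalization \<open>1 / p k\<close>.\<close>

lemma supplemented_costs_locc:
  assumes Ls: "locc_instrument Ls" "k < length Ls"
    and B: "psd 4 B" and D: "psd 4 D" and S: "S \<in> carrier_mat 4 4" "psd 4 (ptranspose 2 2 S)"
    and \<rho>: "\<rho> = S + D" and pt: "psd 4 (ptranspose 2 2 (\<rho> + S + B))" and c: "0 \<le> c"
  shows "c * Re (mat_trace ((Ls ! k) B))
    \<in> supplemented_costs (complex_of_real c \<cdot>\<^sub>m (Ls ! k) \<rho>)"
proof -
  let ?L = "Ls ! k" and ?c = "complex_of_real c"
  note cp = locc_instrument_completely_positive[OF Ls]
  have lin: "linear_mat_map 4 4 ?L"
    using cp by (simp add: completely_positive_def)
  have car: "B \<in> carrier_mat 4 4" "D \<in> carrier_mat 4 4" "\<rho> \<in> carrier_mat 4 4"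
    using B D S \<rho> by (auto simp: psd_def)
  have L_car: "?L X \<in> carrier_mat 4 4" if "X \<in> carrier_mat 4 4" for X
    using lin that by (simp add: linear_mat_map_def)
  have L_add: "?L (X + Y) = ?L X + ?L Y" if "X \<in> carrier_mat 4 4" "Y \<in> carrier_mat 4 4" for X Y
    using lin that by (simp add: linear_mat_map_def)
  have pt_scaled: "psd 4 (ptranspose 2 2 (?c \<cdot>\<^sub>m ?L X))"
    if "X \<in> carrier_mat 4 4" "psd 4 (ptranspose 2 2 X)" for X
    using psd_smult[OF locc_instrument_ptranspose[OF Ls that] c] L_car[OF that(1)]
    by (simp add: ptranspose_smult)
  have distrib: "?c \<cdot>\<^sub>m (X + Y) = ?c \<cdot>\<^sub>m X + ?c \<cdot>\<^sub>m Y"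
    if "X \<in> carrier_mat 4 4" "Y \<in> carrier_mat 4 4" for X Y
    using that by (intro eq_matI) (auto simp: algebra_simps)
  have "Re (mat_trace (?c \<cdot>\<^sub>m ?L B)) \<in> supplemented_costs (?c \<cdot>\<^sub>m ?L \<rho>)"
  proof (rule supplemented_costsI)
    show "psd 4 (?c \<cdot>\<^sub>m ?L B)" "psd 4 (?c \<cdot>\<^sub>m ?L D)"
      using psd_smult[OF completely_positive_psd[OF cp] c] B D by blast+
    show "?c \<cdot>\<^sub>m ?L S \<in> carrier_mat 4 4"
      using L_car[OF S(1)] by simp
    show "psd 4 (ptranspose 2 2 (?c \<cdot>\<^sub>m ?L S))"
      using pt_scaled S by blast
    show "?c \<cdot>\<^sub>m ?L \<rho> = ?c \<cdot>\<^sub>m ?L S + ?c \<cdot>\<^sub>m ?L D"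
      unfolding \<rho> using S(1) car by (simp add: L_add L_car distrib)
    have "?c \<cdot>\<^sub>m ?L (\<rho> + S + B) = ?c \<cdot>\<^sub>m ?L \<rho> + ?c \<cdot>\<^sub>m ?L S + ?c \<cdot>\<^sub>m ?L B"
      using S(1) car by (simp add: L_add L_car distrib assoc_add_mat[of _ 4 4])
    moreover have "\<rho> + S + B \<in> carrier_mat 4 4"
      using S(1) car by simp
    ultimately show "psd 4 (ptranspose 2 2 (?c \<cdot>\<^sub>m ?L \<rho> + ?c \<cdot>\<^sub>m ?L S + ?c \<cdot>\<^sub>m ?L B))"
      using pt_scaled[OF _ pt] by simp
  qed
  then show ?thesis
    using L_car[OF car(1)] by (simp add: mat_trace_smult)
qed

text \<open>Transposing \<open>ketbra u\<close> conjugates \<open>u\<close>, so a product projector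
  stays of the form \<open>ketbra\<close>.\<close>

lemma ptranspose_product:
  assumes "u \<in> carrier_vec m" "v \<in> carrier_vec n"
  shows "ptranspose m n (c \<cdot>\<^sub>m tensor_mat (ketbra u) (ketbra v)) =
    c \<cdot>\<^sub>m ketbra (tensor_vec (conjugate u) v)"
    (is "?A = ?B")
proof (intro eq_matI)
  fix i j
  assume "i < dim_row ?B" and "j < dim_col ?B"
  then have ij: "i < m * n" "j < m * n"
    using assms by (auto simp: ketbra_def tensor_vec_def)
  then have "0 < n"
    by (cases n) auto
  then show "?A $$ (i, j) = ?B $$ (i, j)"
    using assms ij
    by (simp add: ptranspose_def tensor_mat_def ketbra_def tensor_vec_def index_less index_bounds)
qed (use assms in \<open>auto simp: ptranspose_def ketbra_def tensor_vec_def\<close>)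

text \<open>The Peres criterion: each product term keeps a positive partial transpose, and so does
  their sum.\<close>

lemma separable_ptranspose:
  assumes "separable \<rho>"
  shows "psd 4 (ptranspose 2 2 \<rho>)"
proof -
  obtain n and p :: "nat \<Rightarrow> real" and \<psi> \<chi> where
    p: "\<forall>i<n. 0 \<le> p i" and "(\<Sum>i<n. p i) = 1" and
    uv: "\<forall>i<n. unit_vector 2 (\<psi> i) \<and> unit_vector 2 (\<chi> i)" and
    \<rho>: "\<rho> = mat_sum 4
      (\<lambda>i. complex_of_real (p i) \<cdot>\<^sub>m tensor_mat (ketbra (\<psi> i)) (ketbra (\<chi> i))) {..<n}"
    using assms unfolding separable_def by (elim conjE exE) (rule that)
  have "psd 4 (ptranspose 2 2
      (complex_of_real (p i) \<cdot>\<^sub>m tensor_mat (ketbra (\<psi> i)) (ketbra (\<chi> i))))" if "i < n" for i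
  proof -
    have "\<psi> i \<in> carrier_vec 2" "\<chi> i \<in> carrier_vec 2"
      using uv that by (simp_all add: unit_vector_def)
    moreover from this have "tensor_vec (conjugate (\<psi> i)) (\<chi> i) \<in> carrier_vec 4"
      by (intro carrier_vecI) (simp add: tensor_vec_def)
    moreover have "0 \<le> p i"
      using p that by simp
    ultimately show ?thesis
      by (simp only: ptranspose_product psd_smult psd_ketbra)
  qed
  then have "psd 4 (mat_sum 4 (\<lambda>i. ptranspose 2 2
      (complex_of_real (p i) \<cdot>\<^sub>m tensor_mat (ketbra (\<psi> i)) (ketbra (\<chi> i)))) {..<n})"
    by (intro psd_mat_sum) simp
  then show ?thesis
    unfolding \<rho> by (simp add: ptranspose_mat_sum)
qed

lemma entanglement_monotone_supplemented_robustness: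
  "entanglement_monotone supplemented_robustness"
  unfolding entanglement_monotone_def
proof (intro conjI allI impI)
  fix \<rho>
  show nonneg: "0 \<le> supplemented_robustness \<rho>"
    using supplemented_costs_nonneg by (intro supplemented_robustness_ge) auto
  assume sep: "separable \<rho>"
  have c: "\<rho> \<in> carrier_mat 4 4" and \<rho>: "psd 4 \<rho>"
    using sep by (auto simp: separable_def two_qubit_state_def psd_def)
  \<comment> \<open>With \<open>S = 0\<close> and \<open>B = 0\<close> the remaining condition is
    that \<open>\<rho>\<close> has a positive partial transpose.\<close>
  have "Re (mat_trace (0\<^sub>m 4 4)) \<in> supplemented_costs \<rho>"
    using \<rho> c separable_ptranspose[OF sep] psd_zero[of 4] ptranspose_zero[of 2 2]
    by (intro supplemented_costsI[where S = "0\<^sub>m 4 4" and D = \<rho>]) auto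
  then have "supplemented_robustness \<rho> \<le> 0"
    using supplemented_robustness_le[OF insertI2] by (simp add: mat_trace_def)
  then show "supplemented_robustness \<rho> = 0"
    using nonneg by simp
next
  fix \<rho> Ls
  assume state: "two_qubit_state \<rho>" and Ls: "locc_instrument Ls"
  define p where "p = (\<lambda>k. Re (mat_trace ((Ls ! k) \<rho>)))"
  let ?K = "{k. k < length Ls \<and> 0 < p k}"
  let ?E = "\<lambda>k. supplemented_robustness (complex_of_real (1 / p k) \<cdot>\<^sub>m (Ls ! k) \<rho>)"
  \<comment> \<open>Outcomes of probability zero are dropped, hence an inequality. It is used for
    \<open>X = \<rho>\<close>, bounding the total probability, and for \<open>X = B\<close>,
    bounding the total cost.\<close>
  have trace: "(\<Sum>k\<in>?K. Re (mat_trace ((Ls ! k) X))) \<le> Re (mat_trace X)" if X: "psd 4 X" for X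
  proof -
    have "(\<Sum>k\<in>?K. Re (mat_trace ((Ls ! k) X))) \<le> (\<Sum>k<length Ls. Re (mat_trace ((Ls ! k) X)))"
    proof (rule sum_mono2)
      fix k assume "k \<in> {..<length Ls} - ?K"
      then show "0 \<le> Re (mat_trace ((Ls ! k) X))"
        using psd_trace_nonneg[OF completely_positive_psd[OF locc_instrument_completely_positive X]]
          Ls by (simp add: less_eq_complex_def)
    qed auto
    also have "\<dots> = Re (mat_trace X)"
      using quantum_instrument_trace[of 4 4 Ls X] Ls psd_carrier[OF X]
      by (simp add: locc_instrument_def flip: Re_sum)
    finally show ?thesis .
  qed
  \<comment> \<open>The average is bounded by every candidate value for \<open>\<rho>\<close>, hence
    by their infimum; no optimal decomposition has to exist.\<close>
  have "(\<Sum>k\<in>?K. p k * ?E k) \<le> c" if "c \<in> insert 1 (supplemented_costs \<rho>)" for c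
    using that
  proof
    assume "c = 1"
    have "(\<Sum>k\<in>?K. p k * ?E k) \<le> (\<Sum>k\<in>?K. p k)"
      using supplemented_robustness_le[of 1] by (intro sum_mono mult_left_le) auto
    also have "\<dots> \<le> 1"
      using trace[of \<rho>] state unfolding p_def by (simp add: two_qubit_state_def)
    finally show ?thesis
      using \<open>c = 1\<close> by simp
  next
    assume "c \<in> supplemented_costs \<rho>"
    then obtain B S D where c: "c = Re (mat_trace B)" and B: "psd 4 B" and
      rest: "psd 4 D" "S \<in> carrier_mat 4 4" "psd 4 (ptranspose 2 2 S)" "\<rho> = S + D"
      "psd 4 (ptranspose 2 2 (\<rho> + S + B))"
      unfolding supplemented_costs_def by blast
    have "(\<Sum>k\<in>?K. p k * ?E k) \<le> (\<Sum>k\<in>?K. Re (mat_trace ((Ls ! k) B)))"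
    proof (rule sum_mono)
      fix k assume k: "k \<in> ?K"
      have "?E k \<le> 1 / p k * Re (mat_trace ((Ls ! k) B))"
        using k
        by (intro supplemented_robustness_le insertI2 supplemented_costs_locc[OF Ls _ B rest]) auto
      then have "p k * ?E k \<le> p k * (1 / p k * Re (mat_trace ((Ls ! k) B)))"
        using k by (intro mult_left_mono) simp_all
      then show "p k * ?E k \<le> Re (mat_trace ((Ls ! k) B))"
        using k by simp
    qed
    then show ?thesis
      using trace[OF B] c by simp
  qed
  then have "(\<Sum>k\<in>?K. p k * ?E k) \<le> supplemented_robustness \<rho>"
    by (rule supplemented_robustness_ge)
  then show "let p = (\<lambda>k. Re (mat_trace ((Ls ! k) \<rho>))) in
      (\<Sum>k | k < length Ls \<and> 0 < p k.
         p k * supplemented_robustness (complex_of_real (1 / p k) \<cdot>\<^sub>m (Ls ! k) \<rho>))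
      \<le> supplemented_robustness \<rho>"
    by (simp add: p_def Let_def)
qed

section \<open>Two states with spectrum (2/3, 1/3, 0, 0)\<close>

lemma sum_lessThan_4: "(\<Sum>i<4. f i) = f 0 + f 1 + f 2 + f (3::nat)"
  for f :: "nat \<Rightarrow> 'a::comm_monoid_add"
  by (simp add: eval_nat_numeral)

lemma less_4_cases: "i < 4 \<Longrightarrow> i = 0 \<or> i = 1 \<or> i = 2 \<or> i = (3::nat)"
  by linarith

lemma eq_mat4I:
  assumes "A \<in> carrier_mat 4 4" "B \<in> carrier_mat 4 4"
    and "\<forall>i\<in>{0, 1, 2, 3}. \<forall>j\<in>{0, 1, 2, 3}. A $$ (i, j) = B $$ (i, j)"
  shows "A = B"
  using assms less_4_cases by (intro eq_matI) (auto dest!: less_4_cases)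

lemma ket2_eq: "a < 2 \<Longrightarrow> b < 2 \<Longrightarrow> ket2 a b = unit_vec 4 (2 * a + b)"
  unfolding ket2_def tensor_vec_def
  by (intro eq_vecI) (auto dest!: less_4_cases simp: unit_vec_def)

lemma Phi1_eq: "Phi1 = vec 4 (\<lambda>i. if i = 0 \<or> i = 3 then complex_of_real (1 / sqrt 2) else 0)"
  unfolding Phi1_def by (intro eq_vecI) (auto simp: ket2_eq dest!: less_4_cases)

lemma Phi2_eq: "Phi2 = vec 4 (\<lambda>i. if i = 0 then complex_of_real (1 / sqrt 2)
    else if i = 3 then - complex_of_real (1 / sqrt 2) else 0)"
  unfolding Phi2_def by (intro eq_vecI) (auto simp: ket2_eq dest!: less_4_cases)

lemma of_real_sqrt2_mult: "complex_of_real (sqrt 2) * complex_of_real (sqrt 2) = 2"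
  by (metis of_real_mult of_real_numeral real_sqrt_mult_self abs_numeral)

section \<open>The Bell mixture and its spectrum\<close>

definition bell_mixture :: "complex mat" where
  "bell_mixture = complex_of_real (2/3) \<cdot>\<^sub>m ketbra Phi1 + complex_of_real (1/3) \<cdot>\<^sub>m ketbra Phi2"

lemma bell_mixture_eq:
  "bell_mixture = mat_of_rows_list 4
     [[1/2, 0, 0, 1/6], [0, 0, 0, 0], [0, 0, 0, 0], [1/6, 0, 0, 1/2]]"
  by (rule eq_mat4I)
    (auto simp: bell_mixture_def Phi1_eq Phi2_eq ketbra_def mat_of_rows_list_def of_real_sqrt2_mult)

lemma psd_bell_mixture: "psd 4 bell_mixture"
  unfolding bell_mixture_def
  by (intro psd_add psd_smult psd_ketbra) (auto simp: Phi1_eq Phi2_eq)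

lemma two_qubit_state_bell_mixture: "two_qubit_state bell_mixture"
  using psd_bell_mixture
  by (simp add: two_qubit_state_def mat_trace_def bell_mixture_eq mat_of_rows_list_def
      sum_lessThan_4)

text \<open>Explicit diagonalization: the columns of \<open>?P\<close> are eigenvectors, left
  unnormalized to keep \<open>sqrt 2\<close> out of the entries, and \<open>?Q\<close> is the
  inverse of \<open>?P\<close>.\<close>

lemma has_spectrum_bell_mixture: "has_spectrum bell_mixture [2/3, 1/3, 0, 0]"
proof -
  let ?D = "mat_of_rows_list 4 [[2/3, 0, 0, 0], [0, 1/3, 0, 0], [0, 0, 0, 0], [0, 0, 0, 0]]
    :: complex mat"
  let ?P = "mat_of_rows_list 4 [[1, 1, 0, 0], [0, 0, 1, 0], [0, 0, 0, 1], [1, - 1, 0, 0]]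
    :: complex mat"
  let ?Q = "mat_of_rows_list 4 [[1/2, 0, 0, 1/2], [1/2, 0, 0, - 1/2], [0, 1, 0, 0], [0, 0, 1, 0]]
    :: complex mat"
  note simps = mat_of_rows_list_def scalar_prod_def sum_lessThan_4 atLeast0LessThan
  have "similar_mat bell_mixture ?D"
  proof (rule similar_matI)
    show "{bell_mixture, ?D, ?P, ?Q} \<subseteq> carrier_mat 4 4"
      by (auto simp: bell_mixture_eq mat_of_rows_list_def)
    show "?P * ?Q = 1\<^sub>m 4" "?Q * ?P = 1\<^sub>m 4"
      by (rule eq_mat4I; auto simp: simps)+
    show "bell_mixture = ?P * ?D * ?Q"
      unfolding bell_mixture_eq by (rule eq_mat4I) (auto simp: simps)
  qed
  then have "char_poly bell_mixture = char_poly ?D"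
    by (rule char_poly_similar)
  also have "\<dots> = (\<Prod>a\<leftarrow>diag_mat ?D. [:- a, 1:])"
    by (rule char_poly_upper_triangular[of _ 4])
      (auto simp: mat_of_rows_list_def upper_triangular_def less_Suc_eq)
  also have "diag_mat ?D = [2/3, 1/3, 0, 0]"
    by (simp add: diag_mat_def mat_of_rows_list_def upt_rec)
  finally show ?thesis
    by (simp add: has_spectrum_def)
qed

section \<open>Lower bound for the Bell mixture\<close>

lemma index_ptranspose_2:
  "i < 4 \<Longrightarrow> j < 4 \<Longrightarrow>
   ptranspose 2 2 X $$ (i, j) = X $$ (j div 2 * 2 + i mod 2, i div 2 * 2 + j mod 2)"
  by (simp add: ptranspose_def)

text \<open>The block on \<open>|01\<rangle>\<close> and \<open>|10\<rangle>\<close>, which supports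
  the test vectors for partial transposes; its off-diagonal entries are the coherences between
  \<open>|00\<rangle>\<close> and \<open>|11\<rangle>\<close>. The index 1 appears as
  \<open>Suc 0\<close>, its simplified form.\<close>

lemma ptranspose_2_entries:
  "ptranspose 2 2 X $$ (Suc 0, Suc 0) = X $$ (Suc 0, Suc 0)"
  "ptranspose 2 2 X $$ (Suc 0, 2) = X $$ (3, 0)"
  "ptranspose 2 2 X $$ (2, Suc 0) = X $$ (0, 3)"
  "ptranspose 2 2 X $$ (2, 2) = X $$ (2, 2)"
  by (simp_all add: index_ptranspose_2 numeral_2_eq_2[symmetric] numeral_3_eq_3[symmetric])

text \<open>The test vectors are the singlet for \<open>(\<rho> + S + B)\<^sup>\<Gamma>\<close>, its symmetric partner for \<open>S\<^sup>\<Gamma>\<close>, and \<open>\<Phi>\<^sub>1\<close>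
  for \<open>B\<close>.\<close>

lemma supplemented_robustness_bell_mixture: "1/3 \<le> supplemented_robustness bell_mixture"
proof (rule supplemented_robustness_ge)
  fix c
  assume "c \<in> insert 1 (supplemented_costs bell_mixture)"
  then show "1/3 \<le> c"
  proof
    assume "c \<in> supplemented_costs bell_mixture"
    then obtain B S D where c: "c = Re (mat_trace B)" and B: "psd 4 B" and D: "psd 4 D" and
      S: "S \<in> carrier_mat 4 4" "psd 4 (ptranspose 2 2 S)" and sum: "bell_mixture = S + D" and
      pt: "psd 4 (ptranspose 2 2 (bell_mixture + S + B))"
      unfolding supplemented_costs_def by blast
    have car: "B \<in> carrier_mat 4 4" "D \<in> carrier_mat 4 4" "bell_mixture \<in> carrier_mat 4 4"
      using B D psd_bell_mixture by (simp_all add: psd_carrier)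
    define s where "s = S $$ (1, 1) + S $$ (2, 2)"
    define t where "t = S $$ (0, 3) + S $$ (3, 0)"
    \<comment> \<open>\<open>bell_mixture\<close> has no weight on \<open>|01\<rangle>\<close> and
      \<open>|10\<rangle>\<close>, so the diagonal entries of \<open>S\<close> there are the
      negatives of those of \<open>D\<close>.\<close>
    have "0 \<le> D $$ (1, 1)" "0 \<le> D $$ (2, 2)"
      using psd_diag_nonneg[OF D] by simp_all
    moreover have "S $$ (1, 1) + D $$ (1, 1) = 0" "S $$ (2, 2) + D $$ (2, 2) = 0"
      using arg_cong[OF sum, of "\<lambda>A. A $$ (1, 1)"] arg_cong[OF sum, of "\<lambda>A. A $$ (2, 2)"] S(1) car
      by (simp_all add: bell_mixture_eq mat_of_rows_list_def)
    ultimately have 1: "Re s \<le> 0"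
      unfolding s_def less_eq_complex_def by (simp add: complex_eq_iff)
    have "0 \<le> sesq_form 4 (ptranspose 2 2 S) (\<lambda>i. if i = 1 \<or> i = 2 then 1 else 0)"
      by (rule psd_sesq_form[OF S(2)])
    then have 2: "0 \<le> Re s + Re t"
      by (simp add: s_def t_def sesq_form_def sum_lessThan_4 ptranspose_2_entries
          less_eq_complex_def)
    \<comment> \<open>The two coherences \<open>1/6\<close> of \<open>bell_mixture\<close> enter
      with a minus sign and give the bound \<open>1/3\<close>.\<close>
    have "0 \<le> sesq_form 4 (ptranspose 2 2 (bell_mixture + S + B))
        (\<lambda>i. if i = 1 then 1 else if i = 2 then - 1 else 0)"
      by (rule psd_sesq_form[OF pt])
    then have 3: "1/3 \<le> Re s - Re t + Re (B $$ (1, 1)) + Re (B $$ (2, 2))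
        - Re (B $$ (0, 3)) - Re (B $$ (3, 0))"
      using S(1) car
      by (simp add: s_def t_def sesq_form_def sum_lessThan_4 ptranspose_2_entries
          less_eq_complex_def bell_mixture_eq mat_of_rows_list_def)
    have "0 \<le> sesq_form 4 B (\<lambda>i. if i = 0 \<or> i = 3 then 1 else 0)"
      by (rule psd_sesq_form[OF B])
    then have 4: "0 \<le> Re (B $$ (0, 0)) + Re (B $$ (3, 3)) + Re (B $$ (0, 3)) + Re (B $$ (3, 0))"
      by (simp add: sesq_form_def sum_lessThan_4 less_eq_complex_def)
    have "c = Re (B $$ (0, 0)) + Re (B $$ (1, 1)) + Re (B $$ (2, 2)) + Re (B $$ (3, 3))"
      using car by (simp add: c mat_trace_def sum_lessThan_4)
    \<comment> \<open>By 1 and 2 the contribution \<open>Re s - Re t\<close> of \<open>S\<close> is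
      at most 0; by 4 the contribution of \<open>B\<close> in 3 is at most its trace.\<close>
    then show "1/3 \<le> c"
      using 1 2 3 4 by linarith
  qed simp
qed

text \<open>Adding \<open>?S\<close> doubles the weight on \<open>|01\<rangle>\<close> to
  \<open>2/3\<close>. The middle block of the partial transpose then has off-diagonal entries
  \<open>1/3\<close>, and weight \<open>1/6\<close> on \<open>|10\<rangle>\<close> makes its
  determinant zero.\<close>

lemma supplemented_robustness_rho_lambda:
  "supplemented_robustness (rho_lambda (2/3) (1/3) 0 0) \<le> 1/6"
proof -
  let ?\<rho> = "rho_lambda (2/3) (1/3) 0 0"
  let ?S = "complex_of_real (1/3) \<cdot>\<^sub>m ketbra (ket2 0 1)"
  let ?D = "complex_of_real (2/3) \<cdot>\<^sub>m ketbra Phi1"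
  let ?B = "complex_of_real (1/6) \<cdot>\<^sub>m ketbra (ket2 1 0)"
  \<comment> \<open>The resulting singular block is \<open>1/6\<close> times the projector-like
    matrix \<open>ketbra ?w\<close>.\<close>
  let ?w = "vec 4 (\<lambda>i. if i = 1 then 2 else if i = 2 then 1 else 0) :: complex vec"
  note simps = rho_lambda_def Phi1_eq Phi2_eq ket2_eq ketbra_def of_real_sqrt2_mult
  have psd_S: "psd 4 ?S"
    by (intro psd_smult psd_ketbra) (auto simp: ket2_eq)
  have "ptranspose 2 2 ?S = ?S"
    by (rule eq_mat4I) (auto simp: simps index_ptranspose_2, auto simp: ptranspose_def)
  moreover have "ptranspose 2 2 (?\<rho> + ?S + ?B) = complex_of_real (1/3) \<cdot>\<^sub>m ketbra (unit_vec 4 0)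
      + complex_of_real (1/3) \<cdot>\<^sub>m ketbra (unit_vec 4 3) + complex_of_real (1/6) \<cdot>\<^sub>m ketbra ?w"
    by (rule eq_mat4I) (auto simp: simps index_ptranspose_2, auto simp: ptranspose_def)
  moreover have "psd 4 (complex_of_real (1/3) \<cdot>\<^sub>m ketbra (unit_vec 4 0)
      + complex_of_real (1/3) \<cdot>\<^sub>m ketbra (unit_vec 4 3) + complex_of_real (1/6) \<cdot>\<^sub>m ketbra ?w)"
    by (intro psd_add psd_smult psd_ketbra) auto
  moreover have "?\<rho> = ?S + ?D"
    by (rule eq_mat4I) (auto simp: simps)
  moreover have "psd 4 ?B" "psd 4 ?D"
    by (intro psd_smult psd_ketbra; auto simp: ket2_eq Phi1_eq)+
  ultimately have "Re (mat_trace ?B) \<in> supplemented_costs ?\<rho>"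
    using psd_S psd_carrier[OF psd_S] by (intro supplemented_costsI[where S = ?S and D = ?D]) metis+
  moreover have "Re (mat_trace ?B) = 1/6"
    by (simp add: mat_trace_def ket2_eq ketbra_def sum_lessThan_4)
  ultimately show ?thesis
    using supplemented_robustness_le[OF insertI2] by metis
qed

theorem corollary3:
  shows "\<exists>(l1::real) (l2::real) (l3::real) (l4::real) (E :: complex mat \<Rightarrow> real) (\<sigma> :: complex mat).
    l1 \<ge> l2 \<and> l2 \<ge> l3 \<and> l3 \<ge> l4 \<and> l4 \<ge> 0 \<and> l1 + l2 + l3 + l4 = 1 \<and>
    entanglement_monotone E \<and>
    two_qubit_state \<sigma> \<and> has_spectrum \<sigma> [l1, l2, l3, l4] \<and>
    E \<sigma> > E (rho_lambda l1 l2 l3 l4)"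
proof -
  have "supplemented_robustness (rho_lambda (2/3) (1/3) 0 0) < supplemented_robustness bell_mixture"
    using supplemented_robustness_rho_lambda supplemented_robustness_bell_mixture by linarith
  then show ?thesis
    using entanglement_monotone_supplemented_robustness two_qubit_state_bell_mixture
      has_spectrum_bell_mixture
    by (intro exI[of _ "2/3"] exI[of _ "1/3"] exI[of _ 0] exI[of _ supplemented_robustness]
        exI[of _ bell_mixture] conjI) simp_all
qed

end
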